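(* Let $n\ge 3$ be an integer. The disjoint union of the $f_n\times F_{n+1}$ mesh and the $f_n\times F_{n-1}$ mesh can be embedded with dilation 1 into the extended Lucas cube $\mathrm{ELC}(2n+1)$ (that is, the two meshes can be embedded with dilation 1 with vertex-disjoint images), and $\mathrm{ELC}(2n+1)$ is the optimum extended Lucas cube for this, i.e. $2n+1$ is the smallest integer $k\ge 3$ such that $\mathrm{ELC}(k)$ has at least $f_nF_{n+1}+f_nF_{n-1}$ vertices.
   Context: $f_n$ is the $n$-th Fibonacci number: $f_1=f_2=1$, $f_n=f_{n-1}+f_{n-2}$ for $n\ge 3$. Put $F_n=2f_{n-1}$ for $n\ge 2$ (so $F_2=2$, $F_3=2$, $F_4=4$, $F_5=6$). The $a\times b$ mesh is the two-dimensional grid graph with $a$ rows and $b$ columns (the Cartesian product of the paths on $a$ and $b$ vertices). Define sets of binary strings $V_1(k)$, consisting of strings of length $k-2$, by $V_1(2)=\{\lambda\}$ ($\lambda$ the empty string), $V_1(3)=\{0,1\}$, $V_1(4)=\{00,01,10,11\}$, and $V_1(k)=0V_1(k-1)\cup 10V_1(k-2)$ for $k\ge 5$, where $uS=\{us: s\in S\}$ denotes concatenation. Define sets of binary strings $V_2(k)$, consisting of strings of length $k-2$, by $V_2(3)=\{0,1\}$, $V_2(4)=\{00,01,10,11\}$ and, for $k\ge 5$, $V_2(k)=0V_1(k-1)\cup 10V_1(k-3)0$, where $10S0=\{10s0: s\in S\}$. For $k\ge 3$, the extended Lucas cube $\mathrm{ELC}(k)$ is the simple undirected graph with vertex set $V_2(k)$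 in which two vertices are adjacent if and only if they differ in exactly one bit position. An embedding of a graph $G$ into a graph $H$ is an injective map from the vertices of $G$ to the vertices of $H$. Its dilation is the maximum distance in $H$ between images of adjacent vertices of $G$; thus an embedding has dilation 1 if it maps adjacent vertices to adjacent vertices. *)

theory Defs
  imports "Graph_Theory.Graph_Theory" "HOL-Number_Theory.Fib"
begin

text \<open>
  A simple undirected graph is represented as in the locale \<^locale>\<open>pair_graph\<close>: a finite
  loop-free digraph without parallel arcs whose arc relation is symmetric, so that every
  undirected edge occurs as two opposite arcs.
\<close>

lemma pair_graphI:
  assumes "finite (pverts G)"
    and "parcs G \<subseteq> pverts G \<times> pverts G"
    and "\<And>u v. (u, v) \<in> parcs G \<Longrightarrow> (v, u) \<in> parcs G"
    and "\<And>u. (u, u) \<notin> parcs G"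
  shows "pair_graph G"
proof -
  have "finite (parcs G)"
    using assms(1,2) finite_subset by blast
  moreover have "symmetric (with_proj G)"
    using assms(3) by (auto simp: symmetric_def intro!: symI)
  ultimately show ?thesis
    using assms by unfold_locales auto
qed

definition path_graph :: "nat \<Rightarrow> nat pair_pre_digraph" where
  "path_graph n = \<lparr> pverts = {..<n},
     parcs = {(i, j). i < n \<and> j < n \<and> (j = Suc i \<or> i = Suc j)} \<rparr>"

definition cartesian_product ::
  "'a pair_pre_digraph \<Rightarrow> 'b pair_pre_digraph \<Rightarrow> ('a \<times> 'b) pair_pre_digraph" where
  "cartesian_product G H = \<lparr> pverts = pverts G \<times> pverts H,
     parcs = {((u, v), (u', v')).
       (u = u' \<and> u \<in> pverts G \<and> (v, v') \<in> parcs H) \<or>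
       (v = v' \<and> v \<in> pverts H \<and> (u, u') \<in> parcs G)} \<rparr>"

definition mesh :: "nat \<Rightarrow> nat \<Rightarrow> (nat \<times> nat) pair_pre_digraph" where
  "mesh a b = cartesian_product (path_graph a) (path_graph b)"

definition disjoint_union ::
  "'a pair_pre_digraph \<Rightarrow> 'b pair_pre_digraph \<Rightarrow> ('a + 'b) pair_pre_digraph" where
  "disjoint_union G H = \<lparr> pverts = pverts G <+> pverts H,
     parcs = {(Inl u, Inl u') | u u'. (u, u') \<in> parcs G} \<union>
       {(Inr v, Inr v') | v v'. (v, v') \<in> parcs H} \<rparr>"

text \<open>Only the values for \<open>n \<ge> 2\<close> are meaningful.\<close>

definition F :: "nat \<Rightarrow> nat" where
  "F n = 2 * fib (n - 1)"

text \<open>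
  Binary strings are lists of booleans, with \<^term>\<open>False\<close> for the bit 0 and \<^term>\<open>True\<close> for
  the bit 1. The sets below are given the dummy value \<^term>\<open>{}\<close> for those \<open>k\<close> for which they
  are not specified: \<open>k < 2\<close> for \<open>V1\<close> and \<open>k < 3\<close> for \<open>V2\<close>.
\<close>

fun V1 :: "nat \<Rightarrow> bool list set" where
  "V1 k =
    (if k < 2 then {}
     else if k = 2 then {[]}
     else if k = 3 then {[False], [True]}
     else if k = 4 then {[False, False], [False, True], [True, False], [True, True]}
     else {[False] @ s | s. s \<in> V1 (k - 1)} \<union> {[True, False] @ s | s. s \<in> V1 (k - 2)})"

declare V1.simps [simp del]

definition V2 :: "nat \<Rightarrow> bool list set" where
  "V2 k =
    (if k < 3 then {}
     else if k = 3 then {[False], [True]}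
     else if k = 4 then {[False, False], [False, True], [True, False], [True, True]}
     else {[False] @ s | s. s \<in> V1 (k - 1)} \<union>
          {[True, False] @ s @ [False] | s. s \<in> V1 (k - 3)})"

lemma V1_length: "s \<in> V1 k \<Longrightarrow> length s = k - 2"
proof (induction k arbitrary: s rule: less_induct)
  case (less k)
  show ?case
  proof (cases "k < 5")
    case True
    then show ?thesis
      using less.prems by (subst (asm) V1.simps) (auto split: if_splits)
  next
    case False
    then show ?thesis
      using less.prems less.IH[of "k - 1"] less.IH[of "k - 2"]
      by (subst (asm) V1.simps) (auto split: if_splits)
  qed
qed

lemma V2_length: "s \<in> V2 k \<Longrightarrow> length s = k - 2"
  by (auto simp: V2_def dest!: V1_length split: if_splits)

definition hamming_dist :: "bool list \<Rightarrow> bool list \<Rightarrow> nat" where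
  "hamming_dist u v = card {i. i < length u \<and> u ! i \<noteq> v ! i}"

definition ELC :: "nat \<Rightarrow> bool list pair_pre_digraph" where
  "ELC k = \<lparr> pverts = V2 k,
     parcs = {(u, v). u \<in> V2 k \<and> v \<in> V2 k \<and> hamming_dist u v = 1} \<rparr>"

lemma pair_graph_mesh: "pair_graph (mesh a b)"
  by (rule pair_graphI) (auto simp: mesh_def cartesian_product_def path_graph_def)

lemma pair_graph_disjoint_union:
  assumes "pair_graph G" and "pair_graph H"
  shows "pair_graph (disjoint_union G H)"
proof -
  interpret G: pair_graph G by fact
  interpret H: pair_graph H by fact
  show ?thesis
    by (rule pair_graphI)
      (auto simp: disjoint_union_def dest: G.in_arcsD1 G.in_arcsD2 H.in_arcsD1 H.in_arcsD2
        G.pair_no_loops H.pair_no_loops G.arcs_symmetric H.arcs_symmetric)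
qed

lemma pair_graph_ELC: "pair_graph (ELC k)"
proof (rule pair_graphI)
  have "pverts (ELC k) \<subseteq> {s. set s \<subseteq> UNIV \<and> length s = k - 2}"
    by (auto simp: ELC_def V2_length)
  then show "finite (pverts (ELC k))"
    using finite_lists_length_eq[of "UNIV :: bool set"] finite_subset by auto
next
  fix u v assume *: "(u, v) \<in> parcs (ELC k)"
  then have "length u = length v"
    by (auto simp: ELC_def V2_length)
  then have "{i. i < length u \<and> u ! i \<noteq> v ! i} = {i. i < length v \<and> v ! i \<noteq> u ! i}"
    by auto
  then show "(v, u) \<in> parcs (ELC k)"
    using * by (auto simp: ELC_def hamming_dist_def)
qed (auto simp: ELC_def hamming_dist_def)

definition graph_dist :: "'a pair_pre_digraph \<Rightarrow> 'a \<Rightarrow> 'a \<Rightarrow> ereal" where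
  "graph_dist G u v = wf_digraph.\<mu> (with_proj G) (\<lambda>_. 1) u v"

definition embedding ::
  "('a \<Rightarrow> 'b) \<Rightarrow> 'a pair_pre_digraph \<Rightarrow> 'b pair_pre_digraph \<Rightarrow> bool" where
  "embedding \<phi> G H \<longleftrightarrow> \<phi> ` pverts G \<subseteq> pverts H \<and> inj_on \<phi> (pverts G)"

text \<open>
  For a finite graph with at least one edge the supremum is a maximum.
\<close>

definition dilation ::
  "('a \<Rightarrow> 'b) \<Rightarrow> 'a pair_pre_digraph \<Rightarrow> 'b pair_pre_digraph \<Rightarrow> ereal" where
  "dilation \<phi> G H = (SUP (u, v) \<in> parcs G. graph_dist H (\<phi> u) (\<phi> v))"

text \<open>\<open>ELC k\<close> is the smallest extended Lucas cube having at least \<open>N\<close> vertices.\<close>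

definition optimum_ELC :: "nat \<Rightarrow> nat \<Rightarrow> bool" where
  "optimum_ELC N k \<longleftrightarrow>
     3 \<le> k \<and> N \<le> card (pverts (ELC k)) \<and>
     (\<forall>j. 3 \<le> j \<and> N \<le> card (pverts (ELC j)) \<longrightarrow> k \<le> j)"

end

theory Submission
  imports Defs
begin

text \<open>
  Splitting a string of \<open>V1 (2 * n)\<close> or \<open>V1 (2 * n - 2)\<close> after its first \<open>n - 2\<close> bits, and
  putting a bit 0 behind the cut unless only the last, unconstrained bit follows, exhibits inside \<open>ELC (2 * n + 1)\<close> one product of two
  Fibonacci-type cubes among the strings that begin with 0 and another one among the strings
  that begin with 10. All factors have Hamiltonian paths (Gray codes), and the product of two
  paths is a mesh. The smaller cube \<open>ELC (2 * n)\<close> is too small by the addition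
  formula for Fibonacci numbers.
\<close>

section \<open>Hamming distance and Gray paths\<close>

lemma hamming_dist_Nil [simp]: "hamming_dist [] v = 0"
  by (simp add: hamming_dist_def)

lemma hamming_dist_Cons [simp]:
  "hamming_dist (a # u) (b # v) = of_bool (a \<noteq> b) + hamming_dist u v"
proof -
  let ?A = "{i. i < length u \<and> u ! i \<noteq> v ! i}"
  have *: "{i. i < length (a # u) \<and> (a # u) ! i \<noteq> (b # v) ! i} =
      (if a \<noteq> b then {0} else {}) \<union> Suc ` ?A"
  proof (rule set_eqI)
    fix i
    show "i \<in> {i. i < length (a # u) \<and> (a # u) ! i \<noteq> (b # v) ! i} \<longleftrightarrow>
        i \<in> (if a \<noteq> b then {0} else {}) \<union> Suc ` ?A"
      by (cases i) auto
  qed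
  have "card (Suc ` ?A) = card ?A"
    by (simp add: card_image)
  then show ?thesis
    unfolding hamming_dist_def * by simp
qed

lemma hamming_dist_self [simp]: "hamming_dist u u = 0"
  by (simp add: hamming_dist_def)

lemma hamming_dist_append:
  "length u = length u' \<Longrightarrow>
    hamming_dist (u @ v) (u' @ v') = hamming_dist u u' + hamming_dist v v'"
  by (induction u u' rule: list_induct2) auto

lemma hamming_dist_commute: "length u = length v \<Longrightarrow> hamming_dist u v = hamming_dist v u"
  by (induction u v rule: list_induct2) auto

text \<open>A path in the hypercube of dimension \<open>l\<close>. As a list, it lets its positions
  serve as the coordinates along one side of a mesh.\<close>

definition gray_path :: "nat \<Rightarrow> bool list list \<Rightarrow> bool" where
  "gray_path l xs \<longleftrightarrow> distinct xs \<and> (\<forall>u \<in> set xs. length u = l) \<and>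
     successively (\<lambda>u v. hamming_dist u v = 1) xs"

lemma gray_path_rev [simp]: "gray_path l (rev xs) \<longleftrightarrow> gray_path l xs"
proof -
  have "gray_path l (rev xs)" if "gray_path l xs" for xs
    using that unfolding gray_path_def
    by (auto elim!: successively_mono simp: hamming_dist_commute)
  from this[of xs] this[of "rev xs"] show ?thesis
    by auto
qed

lemma gray_path_map_surround:
  assumes "gray_path l xs"
  shows "gray_path (length u + l + length w) (map (\<lambda>x. u @ x @ w) xs)"
  using assms unfolding gray_path_def
  by (auto simp: distinct_map inj_on_def successively_map hamming_dist_append
      elim!: successively_mono)

lemma gray_path_map_Cons: "gray_path l xs \<Longrightarrow> gray_path (Suc l) (map ((#) a) xs)"
  using gray_path_map_surround[of l xs "[a]" "[]"] by simp

lemma gray_path_append: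
  assumes "gray_path l xs" "gray_path l ys" "set xs \<inter> set ys = {}"
    and "xs \<noteq> [] \<Longrightarrow> ys \<noteq> [] \<Longrightarrow> hamming_dist (last xs) (hd ys) = 1"
  shows "gray_path l (xs @ ys)"
  using assms by (auto simp: gray_path_def successively_append_iff)

section \<open>Gray codes of the Fibonacci-type cubes\<close>

text \<open>\<open>fib_code m\<close> enumerates the strings of length \<open>m\<close> without two consecutive ones.
  The two halves are reversed so that they meet at Hamming distance 1.\<close>

fun fib_code :: "nat \<Rightarrow> bool list list" where
  "fib_code 0 = [[]]"
| "fib_code (Suc 0) = [[False], [True]]"
| "fib_code (Suc (Suc m)) = map ((#) False) (rev (fib_code (Suc m))) @
     map (\<lambda>s. True # False # s) (rev (fib_code m))"

lemma length_fib_code: "length (fib_code m) = fib (m + 2)"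
  by (induction m rule: fib_code.induct) auto

lemma fib_code_nonempty [simp]: "fib_code m \<noteq> []"
  by (induction m rule: fib_code.induct) auto

text \<open>Serves the seam of the next code: there the first half ends in 0 followed by this head,
  and the second half starts with the same string except for its first bit.\<close>

lemma hd_fib_code_Suc: "hd (fib_code (Suc m)) = False # hd (rev (fib_code m))"
  by (cases m) (simp_all add: hd_map hd_append)

lemma gray_path_fib_code: "gray_path m (fib_code m)"
proof (induction m rule: fib_code.induct)
  case (3 m)
  have "gray_path (m + 2) (map ((#) False) (rev (fib_code (Suc m))))"
    using 3 gray_path_map_Cons[of "Suc m" "rev (fib_code (Suc m))"] by simp
  moreover have "gray_path (m + 2) (map (\<lambda>s. True # False # s) (rev (fib_code m)))"
    using 3 gray_path_map_surround[of m "rev (fib_code m)" "[True, False]" "[]"] by simp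
  ultimately have "gray_path (m + 2) (fib_code (Suc (Suc m)))"
    unfolding fib_code.simps
    by (rule gray_path_append) (auto simp: last_map last_rev hd_fib_code_Suc hd_map)
  then show ?case by simp
qed (auto simp: gray_path_def)

text \<open>These are the strings of length \<open>m\<close> that may follow any string without consecutive ones,
  even one that ends with 1.\<close>

fun fib_tail :: "nat \<Rightarrow> bool list list" where
  "fib_tail 0 = [[]]"
| "fib_tail (Suc m) = map ((#) False) (fib_code m)"

lemma gray_path_fib_tail: "gray_path m (fib_tail m)"
  by (cases m) (auto simp: gray_path_def[of 0] intro: gray_path_map_Cons gray_path_fib_code)

lemma length_fib_tail: "length (fib_tail m) = fib (m + 1)"
  by (cases m) (simp_all add: length_fib_code)

text \<open>The recursion strips blocks 0 and 10 from \<open>s\<close>. A final lone 1 is completed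
  to a block 10 by the leading 0 of a nonempty \<open>t\<close>.\<close>

lemma fib_code_append_fib_tail:
  "s \<in> set (fib_code a) \<Longrightarrow> t \<in> set (fib_tail b) \<Longrightarrow> s @ t \<in> set (fib_code (a + b))"
proof (induction a arbitrary: s rule: fib_code.induct)
  case 1
  have "t \<in> set (fib_code b)"
    using 1 by (cases b rule: fib_code.cases) auto
  with 1 show ?case by simp
next
  case 2
  have "t \<in> set (fib_code b)"
    using 2 by (cases b rule: fib_code.cases) auto
  with 2 show ?case by (cases b) auto
next
  case (3 m)
  then show ?case by (force simp: image_iff)
qed

text \<open>The last bit of a string of \<open>V1\<close> is free, so the path is walked once with
  bit 0 and back with bit 1. This doubling matches the factor 2 in \<open>F\<close>.\<close>

definition fib_tail_bit :: "nat \<Rightarrow> bool list list" where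
  "fib_tail_bit m = map (\<lambda>s. s @ [False]) (fib_tail m) @ map (\<lambda>s. s @ [True]) (rev (fib_tail m))"

lemma length_fib_tail_bit: "length (fib_tail_bit m) = 2 * fib (m + 1)"
  by (simp add: fib_tail_bit_def length_fib_tail)

lemma gray_path_fib_tail_bit: "gray_path (Suc m) (fib_tail_bit m)"
  unfolding fib_tail_bit_def
proof (rule gray_path_append)
  show "gray_path (Suc m) (map (\<lambda>s. s @ [False]) (fib_tail m))"
    using gray_path_map_surround[of m "fib_tail m" "[]" "[False]"] gray_path_fib_tail by simp
  show "gray_path (Suc m) (map (\<lambda>s. s @ [True]) (rev (fib_tail m)))"
    using gray_path_map_surround[of m "rev (fib_tail m)" "[]" "[True]"] gray_path_fib_tail by simp
qed (auto simp: last_map hd_map hd_rev hamming_dist_append)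

text \<open>Both recursions prepend 0 or 10, and \<open>V1 3\<close> and \<open>V1 4\<close> contain
  all strings of lengths 1 and 2, which leaves the last bit free.\<close>

lemma fib_code_snoc_in_V1: "s \<in> set (fib_code m) \<Longrightarrow> s @ [c] \<in> V1 (m + 3)"
proof (induction m arbitrary: s rule: fib_code.induct)
  case (3 m)
  then show ?case
    by (subst V1.simps) (auto simp: numeral_3_eq_3)
qed (auto simp: V1.simps)

lemma fib_code_append_fib_tail_bit_in_V1:
  assumes "s \<in> set (fib_code a)" "t \<in> set (fib_tail_bit b)"
  shows "s @ t \<in> V1 (a + b + 3)"
proof -
  obtain t' c where "t = t' @ [c]" "t' \<in> set (fib_tail b)"
    using assms(2) by (auto simp: fib_tail_bit_def)
  then show ?thesis
    using fib_code_snoc_in_V1[OF fib_code_append_fib_tail[OF assms(1)], of t' b c] by simp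
qed

section \<open>Meshes in the extended Lucas cube\<close>

lemma pverts_mesh [simp]: "pverts (mesh a b) = {..<a} \<times> {..<b}"
  by (simp add: mesh_def cartesian_product_def path_graph_def)

lemma parcs_mesh:
  "((i, j), (i', j')) \<in> parcs (mesh a b) \<longleftrightarrow> i < a \<and> i' < a \<and> j < b \<and> j' < b \<and>
     (i = i' \<and> (j' = Suc j \<or> j = Suc j') \<or> j = j' \<and> (i' = Suc i \<or> i = Suc i'))"
  by (auto simp: mesh_def cartesian_product_def path_graph_def)

lemma gray_path_nth_adjacent:
  assumes "gray_path l xs" "i < length xs" "i' < length xs" "i' = Suc i \<or> i = Suc i'"
  shows "hamming_dist (xs ! i) (xs ! i') = 1"
proof -
  have "hamming_dist (xs ! k) (xs ! Suc k) = 1" if "Suc k < length xs" for k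
    using assms(1) that unfolding gray_path_def by (blast dest: successively_nth)
  moreover have "length (xs ! i) = length (xs ! i')"
    using assms by (simp add: gray_path_def)
  ultimately show ?thesis
    using assms by (metis hamming_dist_commute)
qed

text \<open>A mesh edge moves one coordinate by one step; the other factor and the frame
  \<open>u\<close>, \<open>w\<close> contribute distance 0.\<close>

lemma gray_paths_mesh_adjacent:
  assumes "gray_path l xs" "gray_path m ys"
    and "((i, j), (i', j')) \<in> parcs (mesh (length xs) (length ys))"
  shows "hamming_dist (u @ xs ! i @ ys ! j @ w) (u @ xs ! i' @ ys ! j' @ w) = 1"
proof -
  have "length (xs ! i) = length (xs ! i')" "length (ys ! j) = length (ys ! j')"
    using assms by (auto simp: gray_path_def parcs_mesh)
  moreover have "hamming_dist (xs ! i) (xs ! i') + hamming_dist (ys ! j) (ys ! j') = 1"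
    using assms by (auto simp: parcs_mesh gray_path_nth_adjacent)
  ultimately show ?thesis
    by (simp add: hamming_dist_append)
qed

lemma gray_paths_mesh_inj:
  assumes "gray_path l xs" "gray_path m ys"
    and "i < length xs" "i' < length xs" "j < length ys" "j' < length ys"
    and "xs ! i @ ys ! j = xs ! i' @ ys ! j'"
  shows "i = i' \<and> j = j'"
proof -
  have "length (xs ! i) = length (xs ! i')"
    using assms by (auto simp: gray_path_def)
  then show ?thesis
    using assms by (auto simp: gray_path_def nth_eq_iff_index_eq)
qed

text \<open>The arc itself is a walk of cost 1, and distinct endpoints rule out the empty
  walk.\<close>

lemma graph_dist_ELC_adjacent:
  assumes "(u, v) \<in> parcs (ELC k)"
  shows "graph_dist (ELC k) u v = 1"
proof -
  interpret pair_graph "ELC k" by (rule pair_graph_ELC)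
  have "u \<noteq> v"
    using pair_no_loops[OF assms] by simp
  have cost: "awalk_cost (\<lambda>_. 1) p = real (length p)" for p :: "(bool list \<times> bool list) list"
    by (induction p) auto
  have "awalk u [(u, v)] v"
    using assms arc_implies_awalk[of "(u, v)"] by auto
  then have "\<mu> (\<lambda>_. 1) u v \<le> awalk_cost (\<lambda>_. 1) [(u, v)]"
    by (rule min_cost_le_walk_cost)
  moreover have "1 \<le> \<mu> (\<lambda>_. 1) u v"
    unfolding \<mu>_def
  proof (rule INF_greatest)
    fix p assume "p \<in> {p. awalk u p v}"
    with \<open>u \<noteq> v\<close> have "p \<noteq> []"
      by (auto simp: awalk_Nil_iff)
    then show "1 \<le> ereal (awalk_cost (\<lambda>_. 1) p)"
      by (cases p) (auto simp: cost)
  qed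
  ultimately show ?thesis
    by (simp add: graph_dist_def cost one_ereal_def)
qed

text \<open>The supremum runs over the constant 1; over an empty arc set it would be
  \<open>-\<infinity>\<close> in \<open>ereal\<close>.\<close>

lemma dilation_ELC_eq_1:
  assumes "parcs G \<noteq> {}"
    and "\<And>u v. (u, v) \<in> parcs G \<Longrightarrow> (\<phi> u, \<phi> v) \<in> parcs (ELC k)"
  shows "dilation \<phi> G (ELC k) = 1"
proof -
  have "dilation \<phi> G (ELC k) = (SUP e \<in> parcs G. 1)"
    unfolding dilation_def
    by (rule SUP_cong) (auto simp: graph_dist_ELC_adjacent assms(2))
  with assms(1) show ?thesis by simp
qed

lemma meshes_embed_ELC:
  assumes "n \<ge> 3"
  defines "G \<equiv> disjoint_union (mesh (fib n) (F (n + 1))) (mesh (fib n) (F (n - 1)))"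
  shows "\<exists>\<phi>. embedding \<phi> G (ELC (2 * n + 1)) \<and> dilation \<phi> G (ELC (2 * n + 1)) = 1"
proof -
  \<comment> \<open>The bit lengths n - 2, n and n - 2 of \<open>X\<close>, \<open>Y\<close>,
    \<open>Z\<close> make both 0XY and 10XZ0 strings of length 2n - 1, and the list lengths are the
    sides of the meshes. For n = 3 the tail in \<open>Z\<close> is empty, so only the free bit
    remains.\<close>
  define X where "X = fib_code (n - 2)"
  define Y where "Y = fib_tail_bit (n - 1)"
  define Z where "Z = fib_tail_bit (n - 3)"
  \<comment> \<open>The prefixes 0 and 10 keep the images of the two meshes disjoint.\<close>
  define \<phi> where "\<phi> = case_sum (\<lambda>(i, j). [False] @ X ! i @ Y ! j @ [])
    (\<lambda>(i, j). [True, False] @ X ! i @ Z ! j @ [False])"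
  have gray: "gray_path (n - 2) X" "gray_path n Y" "gray_path (n - 2) Z"
    using gray_path_fib_code gray_path_fib_tail_bit[of "n - 1"] gray_path_fib_tail_bit[of "n - 3"]
      assms(1) by (auto simp: X_def Y_def Z_def Suc_diff_Suc numeral_2_eq_2 numeral_3_eq_3)
  have len: "length X = fib n" "length Y = F (n + 1)" "length Z = F (n - 1)"
    using assms(1) by (auto simp: X_def Y_def Z_def F_def length_fib_code length_fib_tail_bit
        Suc_diff_Suc numeral_2_eq_2 numeral_3_eq_3)
  have G: "G = disjoint_union (mesh (length X) (length Y)) (mesh (length X) (length Z))"
    by (simp add: G_def len)
  have XY: "s @ t \<in> V1 (2 * n)" if "s \<in> set X" "t \<in> set Y" for s t
    using fib_code_append_fib_tail_bit_in_V1[OF that[unfolded X_def Y_def]] assms(1)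
    by (simp add: algebra_simps mult_2)
  have XZ: "s @ t \<in> V1 (2 * n - 2)" if "s \<in> set X" "t \<in> set Z" for s t
  proof -
    have "n - 2 + (n - 3) + 3 = 2 * n - 2"
      using assms(1) by linarith
    then show ?thesis
      using fib_code_append_fib_tail_bit_in_V1[OF that[unfolded X_def Z_def]] by simp
  qed
  have V2: "V2 (2 * n + 1) = {[False] @ s | s. s \<in> V1 (2 * n)} \<union>
      {[True, False] @ s @ [False] | s. s \<in> V1 (2 * n - 2)}"
    using assms(1) by (simp add: V2_def)
  have verts: "\<phi> v \<in> V2 (2 * n + 1)" if "v \<in> pverts G" for v
  proof -
    from that consider i j where "v = Inl (i, j)" "i < length X" "j < length Y"
      | i j where "v = Inr (i, j)" "i < length X" "j < length Z"
      by (auto simp: G disjoint_union_def)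
    then show ?thesis
    proof cases
      case 1
      then show ?thesis
        using XY[of "X ! i" "Y ! j"] unfolding V2 \<phi>_def by auto
    next
      case 2
      then show ?thesis
        using XZ[of "X ! i" "Z ! j"] unfolding V2 \<phi>_def by auto
    qed
  qed
  have "inj_on \<phi> (pverts G)"
  proof (rule inj_onI)
    fix u v assume "u \<in> pverts G" "v \<in> pverts G" "\<phi> u = \<phi> v"
    \<comment> \<open>Cancels the final 0 in the images of the second mesh, so that
      \<open>gray_paths_mesh_inj\<close> applies.\<close>
    moreover have "xs @ ys @ [c] = xs' @ ys' @ [c] \<longleftrightarrow> xs @ ys = xs' @ ys'"
      for xs ys xs' ys' :: "bool list" and c
      by (metis append_assoc append_same_eq)
    ultimately show "u = v"
      by (auto simp: G disjoint_union_def \<phi>_def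
          dest: gray_paths_mesh_inj[OF gray(1,2)] gray_paths_mesh_inj[OF gray(1,3)])
  qed
  with verts have "embedding \<phi> G (ELC (2 * n + 1))"
    by (auto simp: embedding_def ELC_def)
  moreover have "dilation \<phi> G (ELC (2 * n + 1)) = 1"
  proof (rule dilation_ELC_eq_1)
    \<comment> \<open>This edge exists because \<open>F (n + 1) = 2 * fib n\<close> is at least
      2.\<close>
    have "((0, 0), (0, 1)) \<in> parcs (mesh (length X) (length Y))"
      using assms(1) fib_neq_0_nat[of n]
      by (auto simp: parcs_mesh len F_def)
    then show "parcs G \<noteq> {}"
      by (auto simp: G disjoint_union_def)
  next
    fix u v assume uv: "(u, v) \<in> parcs G"
    then have "u \<in> pverts G" "v \<in> pverts G"
      by (auto simp: G disjoint_union_def parcs_mesh)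
    moreover from uv have "hamming_dist (\<phi> u) (\<phi> v) = 1"
      using gray_paths_mesh_adjacent[OF gray(1,2), of _ _ _ _ "[False]" "[]"]
        gray_paths_mesh_adjacent[OF gray(1,3), of _ _ _ _ "[True, False]" "[False]"]
      by (auto simp: G disjoint_union_def \<phi>_def)
    ultimately show "(\<phi> u, \<phi> v) \<in> parcs (ELC (2 * n + 1))"
      using verts by (simp add: ELC_def)
  qed
  ultimately show ?thesis by blast
qed

section \<open>Optimality\<close>

text \<open>The recursion of \<open>V1\<close> is that of the Fibonacci numbers. An upper bound is
  the direction that excludes smaller cubes.\<close>

lemma finite_V1_card_le: "finite (V1 k) \<and> card (V1 k) \<le> 2 * fib (k - 1)"
proof (induction k rule: less_induct)
  case (less k)
  show ?case
  proof (cases "k < 5")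
    case True
    then consider "k < 2" | "k = 2" | "k = 3" | "k = 4" by linarith
    then show ?thesis
      by cases (simp_all add: V1.simps eval_nat_numeral)
  next
    case False
    then have V1: "V1 k = (@) [False] ` V1 (k - 1) \<union> (@) [True, False] ` V1 (k - 2)"
      by (subst V1.simps) auto
    obtain m where k: "k = m + 5"
      using False by (metis add.commute le_Suc_ex not_less)
    have fin: "finite (V1 (k - 1))" "finite (V1 (k - 2))"
      and le: "card (V1 (k - 1)) \<le> 2 * fib (k - 2)" "card (V1 (k - 2)) \<le> 2 * fib (k - 3)"
      using less.IH[of "k - 1"] less.IH[of "k - 2"] False by (auto simp: numeral_2_eq_2 numeral_3_eq_3)
    have "card (V1 k) \<le> card (V1 (k - 1)) + card (V1 (k - 2))"
      unfolding V1
      by (rule order_trans[OF card_Un_le]) (intro add_mono card_image_le fin)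
    also have "\<dots> \<le> 2 * fib (k - 1)"
      using le by (simp add: k eval_nat_numeral)
    finally show ?thesis
      using fin by (simp add: V1)
  qed
qed

lemma card_V2_le:
  assumes "k \<ge> 5"
  shows "card (V2 k) \<le> 2 * (fib (k - 2) + fib (k - 4))"
proof -
  have V2: "V2 k = (@) [False] ` V1 (k - 1) \<union> (\<lambda>s. [True, False] @ s @ [False]) ` V1 (k - 3)"
    using assms by (auto simp: V2_def)
  have "card (V2 k) \<le> card (V1 (k - 1)) + card (V1 (k - 3))"
    unfolding V2
    by (rule order_trans[OF card_Un_le]) (intro add_mono card_image_le finite_V1_card_le[THEN conjunct1])
  also have "\<dots> \<le> 2 * fib (k - 2) + 2 * fib (k - 4)"
    using finite_V1_card_le[of "k - 1"] finite_V1_card_le[of "k - 3"]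
    by (intro add_mono) (simp_all add: numeral_2_eq_2 numeral_3_eq_3 eval_nat_numeral)
  finally show ?thesis by simp
qed

text \<open>The bound of \<open>card_V2_le\<close> grows with the index; the special cases j = 3, 4
  have at most 4 vertices, against a bound of at least 8.\<close>

lemma card_V2_mono_bound:
  assumes "3 \<le> j" "j \<le> k" "6 \<le> k"
  shows "card (V2 j) \<le> 2 * (fib (k - 2) + fib (k - 4))"
proof (cases "5 \<le> j")
  case True
  then have "card (V2 j) \<le> 2 * (fib (j - 2) + fib (j - 4))"
    by (rule card_V2_le)
  also have "\<dots> \<le> 2 * (fib (k - 2) + fib (k - 4))"
    using assms by (intro mult_le_mono2 add_mono fib_mono) auto
  finally show ?thesis .
next
  case False
  with assms have "j = 3 \<or> j = 4" by auto
  then have "card (V2 j) \<le> 4"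
    by (auto simp: V2_def)
  also have "\<dots> \<le> 2 * (fib 4 + fib 2)"
    by (simp add: eval_nat_numeral)
  also have "\<dots> \<le> 2 * (fib (k - 2) + fib (k - 4))"
    using assms by (intro mult_le_mono2 add_mono fib_mono) auto
  finally show ?thesis .
qed

text \<open>Twice the left side bounds the size of \<open>ELC (2 * n)\<close>, twice the right side
  counts the mesh vertices. In terms of a = \<open>fib (n - 3)\<close> and b =
  \<open>fib (n - 2)\<close> the difference is 2bb - ab, which is positive since a \<le> b and b >
  0.\<close>

lemma fib_product_gt:
  assumes "n \<ge> 3"
  shows "fib (2 * n - 2) + fib (2 * n - 4) < fib n * (fib n + fib (n - 2))"
proof -
  obtain m where n: "n = m + 3"
    using assms by (metis add.commute le_Suc_ex)
  define a b where "a = fib m" and "b = fib (Suc m)"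
  have "a \<le> b" "0 < b"
    by (simp_all add: a_def b_def fib_Suc_mono fib_neq_0_nat)
  have odd: "fib (Suc (2 * m)) = a * a + b * b"
    using fib_add[of m m] by (simp add: a_def b_def mult_2)
  have even: "fib (Suc (Suc (2 * m))) = b * (a + b) + a * b"
    using fib_add[of "Suc m" m] by (simp add: a_def b_def mult_2 ring_distribs)
  have "2 * n - 2 = Suc (Suc (Suc (Suc (2 * m))))" "2 * n - 4 = Suc (Suc (2 * m))"
    using n by simp_all
  then have "fib (2 * n - 2) + fib (2 * n - 4) = 3 * fib (Suc (Suc (2 * m))) + fib (Suc (2 * m))"
    by simp
  also have "\<dots> = a * a + 6 * (a * b) + 4 * (b * b)"
    unfolding odd even by (simp add: algebra_simps)
  also have "\<dots> < a * a + 5 * (a * b) + 6 * (b * b)"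
    using mult_le_mono1[OF \<open>a \<le> b\<close>, of b] mult_pos_pos[OF \<open>0 < b\<close> \<open>0 < b\<close>] by linarith
  also have "\<dots> = fib n * (fib n + fib (n - 2))"
    by (simp add: n a_def b_def eval_nat_numeral algebra_simps)
  finally show ?thesis .
qed

theorem theorem7:
  fixes n :: nat
  assumes "n \<ge> 3"
  shows "(\<exists>\<phi>.
            embedding \<phi>
              (disjoint_union (mesh (fib n) (F (n + 1))) (mesh (fib n) (F (n - 1))))
              (ELC (2 * n + 1)) \<and>
            dilation \<phi>
              (disjoint_union (mesh (fib n) (F (n + 1))) (mesh (fib n) (F (n - 1))))
              (ELC (2 * n + 1)) = 1) \<and>
         optimum_ELC (fib n * F (n + 1) + fib n * F (n - 1)) (2 * n + 1)"
proof -
  let ?G = "disjoint_union (mesh (fib n) (F (n + 1))) (mesh (fib n) (F (n - 1)))"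
  let ?N = "fib n * F (n + 1) + fib n * F (n - 1)"
  obtain \<phi> where \<phi>: "embedding \<phi> ?G (ELC (2 * n + 1))" "dilation \<phi> ?G (ELC (2 * n + 1)) = 1"
    using meshes_embed_ELC[OF assms] by blast
  have "optimum_ELC ?N (2 * n + 1)"
    unfolding optimum_ELC_def
  proof (intro conjI allI impI)
    show "3 \<le> 2 * n + 1"
      using assms by simp
    have "finite (pverts (ELC (2 * n + 1)))"
      using pair_graph_ELC[of "2 * n + 1"]
      by (intro pair_fin_digraph.pair_finite_verts) (simp add: pair_graph_def pair_digraph_def)
    \<comment> \<open>Injectivity of the embedding already shows that the cube is large
      enough.\<close>
    then have "card (pverts ?G) \<le> card (pverts (ELC (2 * n + 1)))"
      using \<phi>(1) by (auto simp: embedding_def intro: card_inj_on_le)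
    then show "?N \<le> card (pverts (ELC (2 * n + 1)))"
      by (simp add: disjoint_union_def card_Plus)
  next
    fix j assume j: "3 \<le> j \<and> ?N \<le> card (pverts (ELC j))"
    show "2 * n + 1 \<le> j"
    proof (rule ccontr)
      assume "\<not> 2 * n + 1 \<le> j"
      \<comment> \<open>A smaller cube has j \<le> 2n, and 2n \<ge> 6, so the monotone bound is
        taken at k = 2n.\<close>
      then have "card (V2 j) \<le> 2 * (fib (2 * n - 2) + fib (2 * n - 4))"
        using j assms by (intro card_V2_mono_bound) auto
      also have "\<dots> < 2 * (fib n * (fib n + fib (n - 2)))"
        using fib_product_gt[OF assms] by simp
      also have "\<dots> = ?N"
        using assms by (simp add: F_def algebra_simps numeral_2_eq_2)
      finally show False
        using j by (simp add: ELC_def)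
    qed
  qed
  with \<phi> show ?thesis by blast
qed

end
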